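(* Let $$G=\langle X,Y,Z \mid X^3=Y^3=Z^2=1,\ XY=YX,\ XZ=ZX^{-1},\ YZ=ZY^{-1}\rangle$$ (the generalized dihedral group of $\mathbb{Z}_3\times\mathbb{Z}_3$, of order 18, SmallGroup(18,4) in GAP's library), and let $\mathcal{S}(G)\subseteq\mathbb{Z}$ be the set of integer group determinants for $G$. Then: (i) the elements of $\mathcal{S}(G)$ coprime to $6$ are exactly the integers $m$ with $m\equiv \pm 1 \pmod{18}$; (ii) the elements of $\mathcal{S}(G)$ divisible by $6$ are exactly the integers $2^2\cdot 3^9 m$ with $m\in\mathbb{Z}$; (iii) the elements of $\mathcal{S}(G)$ divisible by $2$ but not by $3$ are exactly the integers $2^2(9m+ 2)$ and $2^2(9m-2)$ with $m\in\mathbb{Z}$; (iv) the elements of $\mathcal{S}(G)$ divisible by $3$ but not by $2$ are exactly the integers $3^9(2m+1)$ with $m\in\mathbb{Z}$.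
   Context: For a finite group $G$ and an element $\sum_{g\in G}a_g g$ of the integral group ring $\mathbb{Z}[G]$, the integer group determinant is $$\mathcal{D}_G\Big(\sum_{g\in G}a_g g\Big):=\det\big(a_{gh^{-1}}\big)_{g,h\in G},$$ the determinant of the $|G|\times|G|$ matrix whose rows are indexed by $g\in G$ and columns by $h\in G$ (in the same order). The set of integer group determinants for $G$ is $\mathcal{S}(G):=\{\mathcal{D}_G(F) : F\in\mathbb{Z}[G]\}$. $\mathbb{Z}_n$ denotes the cyclic group of order $n$. *)

theory Defs
  imports "HOL-Number_Theory.Cong" "HOL-Algebra.Group" "Jordan_Normal_Form.Determinant"
begin

section \<open>Groups given by generators and relations\<close>

datatype 'x letter = Gen 'x | Inv 'x

type_synonym 'x word = "'x letter list"

text \<open>A set \<open>R\<close> of pairs of words stands for the defining relations \<open>u = v\<close> with \<open>(u, v) \<in> R\<close>.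
  \<open>word_eq R\<close> is the least congruence on words that contains \<open>R\<close> and makes \<open>Inv x\<close> a two-sided
  inverse of \<open>Gen x\<close>, so the quotient is the free group on \<open>'x\<close> modulo the normal closure of the
  relators \<open>u v\<^sup>-\<^sup>1\<close>.\<close>

inductive word_eq :: "('x word \<times> 'x word) set \<Rightarrow> 'x word \<Rightarrow> 'x word \<Rightarrow> bool"
  for R where
  relation: "(u, v) \<in> R \<Longrightarrow> word_eq R u v"
| Gen_Inv: "word_eq R [Gen x, Inv x] []"
| Inv_Gen: "word_eq R [Inv x, Gen x] []"
| refl: "word_eq R u u"
| sym: "word_eq R u v \<Longrightarrow> word_eq R v u"
| trans: "word_eq R u v \<Longrightarrow> word_eq R v w \<Longrightarrow> word_eq R u w"
| append: "word_eq R u u' \<Longrightarrow> word_eq R v v' \<Longrightarrow> word_eq R (u @ v) (u' @ v')"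

definition word_class :: "('x word \<times> 'x word) set \<Rightarrow> 'x word \<Rightarrow> 'x word set" where
  "word_class R u = {v. word_eq R u v}"

definition presented_group :: "('x word \<times> 'x word) set \<Rightarrow> 'x word set monoid" where
  "presented_group R =
     \<lparr>carrier = range (word_class R),
      mult = (\<lambda>A B. \<Union>u\<in>A. \<Union>v\<in>B. word_class R (u @ v)),
      one = word_class R []\<rparr>"

lemma word_class_eq_iff: "word_class R u = word_class R v \<longleftrightarrow> word_eq R u v"
  unfolding word_class_def set_eq_iff mem_Collect_eq
  by (meson word_eq.refl word_eq.sym word_eq.trans)

lemma presented_group_mult:
  "word_class R u \<otimes>\<^bsub>presented_group R\<^esub> word_class R v = word_class R (u @ v)"
proof -
  have "word_class R (u' @ v') = word_class R (u @ v)"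
    if "u' \<in> word_class R u" "v' \<in> word_class R v" for u' v'
    using that unfolding word_class_eq_iff
    by (simp add: word_class_def word_eq.append word_eq.sym)
  moreover have "u \<in> word_class R u" "v \<in> word_class R v"
    by (simp_all add: word_class_def word_eq.refl)
  ultimately have "(\<Union>u'\<in>word_class R u. \<Union>v'\<in>word_class R v. word_class R (u' @ v'))
      = word_class R (u @ v)"
    by blast
  then show ?thesis
    by (simp add: presented_group_def)
qed

fun letter_inv :: "'x letter \<Rightarrow> 'x letter" where
  "letter_inv (Gen x) = Inv x"
| "letter_inv (Inv x) = Gen x"

lemma word_inv_eq: "word_eq R (rev (map letter_inv w) @ w) []"
proof (induction w)
  case Nil
  show ?case by (simp add: word_eq.refl)
next
  case (Cons l w)
  have "word_eq R [letter_inv l, l] []"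
    by (cases l) (simp_all add: word_eq.Gen_Inv word_eq.Inv_Gen)
  then have "word_eq R ([letter_inv l, l] @ w) ([] @ w)"
    by (rule word_eq.append) (rule word_eq.refl)
  then have "word_eq R (rev (map letter_inv w) @ [letter_inv l, l] @ w)
      (rev (map letter_inv w) @ [] @ w)"
    by (rule word_eq.append[OF word_eq.refl])
  then have "word_eq R (rev (map letter_inv (l # w)) @ l # w) (rev (map letter_inv w) @ w)"
    by simp
  then show ?case
    using Cons.IH by (rule word_eq.trans)
qed

lemma group_presented_group: "group (presented_group R)"
proof (rule groupI)
  have carrier: "carrier (presented_group R) = range (word_class R)"
    and one: "\<one>\<^bsub>presented_group R\<^esub> = word_class R []"
    by (simp_all add: presented_group_def)
  show "\<one>\<^bsub>presented_group R\<^esub> \<in> carrier (presented_group R)"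
    by (simp add: carrier one)
  fix A assume A: "A \<in> carrier (presented_group R)"
  then obtain u where u: "A = word_class R u"
    by (auto simp: carrier)
  show "\<one>\<^bsub>presented_group R\<^esub> \<otimes>\<^bsub>presented_group R\<^esub> A = A"
    by (simp add: u one presented_group_mult)
  show "\<exists>B\<in>carrier (presented_group R). B \<otimes>\<^bsub>presented_group R\<^esub> A = \<one>\<^bsub>presented_group R\<^esub>"
    using word_inv_eq[of R u]
    by (auto simp: u one carrier presented_group_mult word_class_eq_iff)
  fix B assume B: "B \<in> carrier (presented_group R)"
  then show "A \<otimes>\<^bsub>presented_group R\<^esub> B \<in> carrier (presented_group R)"
    using A by (auto simp: carrier presented_group_mult)
  fix C assume "C \<in> carrier (presented_group R)"
  with A B show "A \<otimes>\<^bsub>presented_group R\<^esub> B \<otimes>\<^bsub>presented_group R\<^esub> C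
      = A \<otimes>\<^bsub>presented_group R\<^esub> (B \<otimes>\<^bsub>presented_group R\<^esub> C)"
    by (auto simp: carrier presented_group_mult)
qed


section \<open>Integer group determinants\<close>

text \<open>The element \<open>\<Sum>g. a g \<cdot> g\<close> of the integral group ring is its coefficient function.\<close>

definition integral_group_ring :: "('g, 'b) monoid_scheme \<Rightarrow> ('g \<Rightarrow> int) set" where
  "integral_group_ring G = {a. finite {g. a g \<noteq> 0} \<and> {g. a g \<noteq> 0} \<subseteq> carrier G}"

text \<open>Library matrices are indexed by \<open>{0..<n}\<close>, so the finite group is enumerated; the rows and
  the columns use the same enumeration \<open>e\<close>.\<close>

definition group_matrix ::
    "('g, 'b) monoid_scheme \<Rightarrow> (nat \<Rightarrow> 'g) \<Rightarrow> ('g \<Rightarrow> int) \<Rightarrow> int mat" where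
  "group_matrix G e a =
     mat (card (carrier G)) (card (carrier G)) (\<lambda>(i, j). a (e i \<otimes>\<^bsub>G\<^esub> inv\<^bsub>G\<^esub> (e j)))"

text \<open>The choice of the enumeration is irrelevant by \<open>group_det_eq\<close> below.\<close>

definition group_det :: "('g, 'b) monoid_scheme \<Rightarrow> ('g \<Rightarrow> int) \<Rightarrow> int" where
  "group_det G a =
     det (group_matrix G (SOME e. bij_betw e {0..<card (carrier G)} (carrier G)) a)"

definition integer_group_dets :: "('g, 'b) monoid_scheme \<Rightarrow> int set" where
  "integer_group_dets G = group_det G ` integral_group_ring G"

lemma det_permute_rows_cols:
  fixes A :: "int mat"
  assumes A: "A \<in> carrier_mat n n" and p: "p permutes {0..<n}"
  shows "det (mat n n (\<lambda>(i, j). A $$ (p i, p j))) = det A"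
proof -
  have lt: "p i < n" if "i < n" for i
    using permutes_in_image[OF p, of i] that by auto
  define B where "B = mat n n (\<lambda>(i, j). A $$ (p i, j))"
  have B: "B \<in> carrier_mat n n" "B\<^sup>T \<in> carrier_mat n n"
    by (auto simp: B_def)
  have "mat n n (\<lambda>(i, j). A $$ (p i, p j)) = (mat n n (\<lambda>(i, j). B\<^sup>T $$ (p i, j)))\<^sup>T"
    by (rule eq_matI) (auto simp: B_def lt)
  then have "det (mat n n (\<lambda>(i, j). A $$ (p i, p j))) = det (mat n n (\<lambda>(i, j). B\<^sup>T $$ (p i, j)))"
    by (simp add: det_transpose[of _ n])
  also have "\<dots> = signof p * det B"
    using det_permute_rows[OF B(2) p] det_transpose[OF B(1)] by simp
  also have "det B = signof p * det A"
    using det_permute_rows[OF A p] by (simp add: B_def)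
  finally show ?thesis
    by (simp add: sign_def)
qed

lemma group_det_eq:
  assumes e: "bij_betw e {0..<card (carrier G)} (carrier G)"
  shows "group_det G a = det (group_matrix G e a)"
proof -
  let ?n = "card (carrier G)"
  define e' where "e' = (SOME e. bij_betw e {0..<?n} (carrier G))"
  have e': "bij_betw e' {0..<?n} (carrier G)"
    unfolding e'_def by (rule someI[where P = "\<lambda>e. bij_betw e {0..<?n} (carrier G)", OF e])
  define q where "q = inv_into {0..<?n} e \<circ> e'"
  define p where "p i = (if i \<in> {0..<?n} then q i else i)" for i
  have "bij_betw q {0..<?n} {0..<?n}"
    unfolding q_def using e' bij_betw_inv_into[OF e] by (rule bij_betw_trans)
  then have "bij_betw p {0..<?n} {0..<?n}"
    by (rule iffD1[OF bij_betw_cong, rotated]) (simp add: p_def)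
  then have p: "p permutes {0..<?n}"
    by (rule bij_imp_permutes) (simp add: p_def)
  have p_lt: "p i < ?n" if "i < ?n" for i
    using permutes_in_image[OF p, of i] that by auto
  have e_p: "e (p i) = e' i" if "i < ?n" for i
  proof -
    have "e' i \<in> carrier G"
      using bij_betwE[OF e'] that by auto
    then show ?thesis
      using bij_betw_inv_into_right[OF e] that by (simp add: p_def q_def)
  qed
  have "group_matrix G e' a = mat ?n ?n (\<lambda>(i, j). group_matrix G e a $$ (p i, p j))"
    by (rule eq_matI) (auto simp: group_matrix_def p_lt e_p)
  then have "det (group_matrix G e' a) = det (group_matrix G e a)"
    using det_permute_rows_cols[OF _ p, of "group_matrix G e a"] by (simp add: group_matrix_def)
  then show ?thesis
    unfolding group_det_def e'_def .
qed


section \<open>The generalized dihedral group of \<open>\<int>\<^sub>3 \<times> \<int>\<^sub>3\<close>\<close>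

datatype generator = X | Y | Z

definition gen_dihedral_Z3_Z3 :: "generator word set monoid" where
  "gen_dihedral_Z3_Z3 = presented_group
     {([Gen X, Gen X, Gen X], []),
      ([Gen Y, Gen Y, Gen Y], []),
      ([Gen Z, Gen Z], []),
      ([Gen X, Gen Y], [Gen Y, Gen X]),
      ([Gen X, Gen Z], [Gen Z, Inv X]),
      ([Gen Y, Gen Z], [Gen Z, Inv Y])}"

end

theory Submission
  imports Defs "HOL-Library.Numeral_Type" "HOL-Library.Product_Plus"
begin

text \<open>Write an element of the group ring as \<open>f + g Z\<close> with \<open>f\<close>, \<open>g\<close> in the group ring of
  \<open>A = \<int>\<^sub>3 \<times> \<int>\<^sub>3\<close>. The group matrix splits into four commuting blocks, so its determinant is that of
  the convolution matrix of \<open>h = f f\<^sup>* - g g\<^sup>*\<close>, where \<open>*\<close> inverts the elements of \<open>A\<close>. Since \<open>h\<close> is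
  even, it is given by \<open>h 0\<close> and its values \<open>c\<^sub>1, \<dots>, c\<^sub>4\<close> on the four subgroups of order 3. With
  \<open>S = c\<^sub>1 + \<dots> + c\<^sub>4\<close> and \<open>t = h 0 - S\<close> the determinant is \<open>(t + 3 S) (\<Prod>\<^sub>i (t + 3 c\<^sub>i))\<^sup>2\<close>, and
  \<open>t + 3 S = (\<Sum> f)\<^sup>2 - (\<Sum> g)\<^sup>2\<close>. Hence it is \<open>t\<^sup>9\<close> modulo 9, divisible by \<open>3\<^sup>9\<close> when 3 divides \<open>t\<close>,
  and divisible by 4 when it is even. Conversely, adding \<open>k\<close> to every coefficient of \<open>f\<close> and \<open>g\<close> keeps
  the four squared factors and moves the first by \<open>18 k (\<Sum> f - \<Sum> g)\<close>, and exchanging \<open>f\<close> and \<open>g\<close>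
  changes the sign; so finitely many examples yield all the remaining values.\<close>

section \<open>Difference matrices over finite abelian groups\<close>

definition convolution :: "('a::{finite,ab_group_add} \<Rightarrow> int) \<Rightarrow> ('a \<Rightarrow> int) \<Rightarrow> 'a \<Rightarrow> int" where
  "convolution f g x = (\<Sum>y\<in>UNIV. f (x - y) * g y)"

definition difference_matrix :: "nat \<Rightarrow> (nat \<Rightarrow> 'a::ab_group_add) \<Rightarrow> ('a \<Rightarrow> int) \<Rightarrow> int mat" where
  "difference_matrix n p f = mat n n (\<lambda>(i, j). f (p i - p j))"

lemma difference_matrix_carrier [simp]: "difference_matrix n p f \<in> carrier_mat n n"
  by (simp add: difference_matrix_def)

lemma transpose_difference_matrix:
  "(difference_matrix n p f)\<^sup>T = difference_matrix n p (\<lambda>x. f (- x))"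
  by (rule eq_matI) (auto simp: difference_matrix_def)

lemma convolution_commute: "convolution f g = convolution g f"
proof
  fix x
  show "convolution f g x = convolution g f x"
    unfolding convolution_def
    by (rule sum.reindex_bij_witness[where i = "\<lambda>y. x - y" and j = "\<lambda>y. x - y"]) auto
qed

lemma sum_difference_reindex:
  fixes p :: "nat \<Rightarrow> 'a::{finite,ab_group_add}" and F :: "'a \<Rightarrow> int"
  assumes p: "bij_betw p {0..<n} UNIV"
  shows "(\<Sum>k = 0..<n. F (p k - c)) = (\<Sum>y\<in>UNIV. F y)"
proof -
  have "(\<Sum>k = 0..<n. F (p k - c)) = (\<Sum>y\<in>UNIV. F (y - c))"
    by (rule sum.reindex_bij_betw[OF p])
  also have "\<dots> = (\<Sum>y\<in>UNIV. F y)"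
    by (rule sum.reindex_bij_witness[where i = "\<lambda>y. y + c" and j = "\<lambda>y. y - c"]) auto
  finally show ?thesis .
qed

lemma difference_matrix_mult:
  fixes p :: "nat \<Rightarrow> 'a::{finite,ab_group_add}"
  assumes p: "bij_betw p {0..<n} UNIV"
  shows "difference_matrix n p f * difference_matrix n p g = difference_matrix n p (convolution f g)"
proof (rule eq_matI)
  fix i j assume "i < dim_row (difference_matrix n p (convolution f g))"
    "j < dim_col (difference_matrix n p (convolution f g))"
  then have ij: "i < n" "j < n" by (simp_all add: difference_matrix_def)
  then have "(difference_matrix n p f * difference_matrix n p g) $$ (i, j)
      = (\<Sum>k = 0..<n. f (p i - p j - (p k - p j)) * g (p k - p j))"
    by (simp add: difference_matrix_def scalar_prod_def)
  also have "\<dots> = convolution f g (p i - p j)"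
    unfolding convolution_def
    by (rule sum_difference_reindex[OF p, where F = "\<lambda>y. f (p i - p j - y) * g y"])
  finally show "(difference_matrix n p f * difference_matrix n p g) $$ (i, j)
      = difference_matrix n p (convolution f g) $$ (i, j)"
    using ij by (simp add: difference_matrix_def)
qed (simp_all add: difference_matrix_def)

definition autocorrelation :: "('a::{finite,ab_group_add} \<Rightarrow> int) \<Rightarrow> 'a \<Rightarrow> int" where
  "autocorrelation f x = (\<Sum>y\<in>UNIV. f (x + y) * f y)"

lemma autocorrelation_uminus: "autocorrelation f (- x) = autocorrelation f x"
  unfolding autocorrelation_def
  by (rule sum.reindex_bij_witness[where i = "\<lambda>y. x + y" and j = "\<lambda>y. y - x"])
    (auto simp: mult.commute)

lemma convolution_reflect: "convolution f (\<lambda>x. f (- x)) = autocorrelation f"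
proof
  fix x
  show "convolution f (\<lambda>x. f (- x)) x = autocorrelation f x"
    unfolding convolution_def autocorrelation_def
    by (rule sum.reindex_bij_witness[where i = "\<lambda>y. - y" and j = "\<lambda>y. - y"]) auto
qed

lemma sum_autocorrelation: "(\<Sum>x\<in>UNIV. autocorrelation f x) = (\<Sum>x\<in>UNIV. f x)\<^sup>2"
proof -
  have "(\<Sum>x\<in>UNIV. autocorrelation f x) = (\<Sum>y\<in>UNIV. (\<Sum>x\<in>UNIV. f (x + y)) * f y)"
    unfolding autocorrelation_def sum_distrib_right by (rule sum.swap)
  also have "(\<Sum>x\<in>UNIV. f (x + y)) = (\<Sum>x\<in>UNIV. f x)" for y
    by (rule sum.reindex_bij_witness[where i = "\<lambda>x. x - y" and j = "\<lambda>x. x + y"]) auto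
  then have "(\<Sum>y\<in>UNIV. (\<Sum>x\<in>UNIV. f (x + y)) * f y) = (\<Sum>x\<in>UNIV. f x)\<^sup>2"
    by (simp add: power2_eq_square sum_distrib_left)
  finally show ?thesis .
qed

lemma det_dihedral_block:
  fixes p :: "nat \<Rightarrow> 'a::{finite,ab_group_add}"
  assumes p: "bij_betw p {0..<n} UNIV"
  shows "det (four_block_mat (difference_matrix n p f) (difference_matrix n p g)
      (difference_matrix n p g)\<^sup>T (difference_matrix n p f)\<^sup>T)
    = det (difference_matrix n p (\<lambda>x. autocorrelation f x - autocorrelation g x))"
proof -
  have "(difference_matrix n p g)\<^sup>T * (difference_matrix n p f)\<^sup>T
      = (difference_matrix n p f)\<^sup>T * (difference_matrix n p g)\<^sup>T"
    unfolding transpose_difference_matrix difference_matrix_mult[OF p]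
    by (subst convolution_commute) (rule HOL.refl)
  then have "det (four_block_mat (difference_matrix n p f) (difference_matrix n p g)
      (difference_matrix n p g)\<^sup>T (difference_matrix n p f)\<^sup>T)
    = det (difference_matrix n p f * (difference_matrix n p f)\<^sup>T
        - difference_matrix n p g * (difference_matrix n p g)\<^sup>T)"
    by (intro det_four_block_mat[where n = n]) (auto simp: transpose_difference_matrix)
  also have "difference_matrix n p f * (difference_matrix n p f)\<^sup>T
        - difference_matrix n p g * (difference_matrix n p g)\<^sup>T
      = difference_matrix n p (\<lambda>x. autocorrelation f x - autocorrelation g x)"
    unfolding transpose_difference_matrix difference_matrix_mult[OF p] convolution_reflect
    by (rule eq_matI) (auto simp: difference_matrix_def)
  finally show ?thesis .
qed

section \<open>The presented group\<close>

type_synonym Z3_sq = "3 \<times> 3"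

lemma exhaust_Z3: "i = 0 \<or> i = 1 \<or> i = 2" for i :: 3
proof (induct i)
  case (of_int z)
  then have "z = 0 \<or> z = 1 \<or> z = 2" by auto
  then show ?case by auto
qed

lemma UNIV_Z3: "(UNIV :: 3 set) = {0, 1, 2}"
  using exhaust_Z3 by auto

lemma minus_Z3 [simp]: "- 1 = (2 :: 3)" "- 2 = (1 :: 3)"
  by (simp_all add: neg_eq_iff_add_eq_0)

lemma UNIV_Z3_sq: "(UNIV :: Z3_sq set)
    = {(0,0), (0,1), (0,2), (1,0), (1,1), (1,2), (2,0), (2,1), (2,2)}"
  unfolding UNIV_Times_UNIV[symmetric] UNIV_Z3 by auto

lemma sum_Z3_sq: "(\<Sum>x\<in>UNIV. F (x :: Z3_sq)) = F (0,0) + F (0,1) + F (0,2)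
    + F (1,0) + F (1,1) + F (1,2) + F (2,0) + F (2,1) + F (2,2)" for F :: "Z3_sq \<Rightarrow> int"
  unfolding UNIV_Z3_sq by simp

fun letter_action :: "generator letter \<Rightarrow> Z3_sq \<times> bool \<Rightarrow> Z3_sq \<times> bool" where
  "letter_action (Gen X) (a, s) = (a + (1, 0), s)"
| "letter_action (Inv X) (a, s) = (a - (1, 0), s)"
| "letter_action (Gen Y) (a, s) = (a + (0, 1), s)"
| "letter_action (Inv Y) (a, s) = (a - (0, 1), s)"
| "letter_action (Gen Z) (a, s) = (- a, \<not> s)"
| "letter_action (Inv Z) (a, s) = (- a, \<not> s)"

abbreviation word_action :: "generator word \<Rightarrow> Z3_sq \<times> bool \<Rightarrow> Z3_sq \<times> bool" where
  "word_action \<equiv> foldr letter_action"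

definition relations :: "(generator word \<times> generator word) set" where
  "relations =
     {([Gen X, Gen X, Gen X], []),
      ([Gen Y, Gen Y, Gen Y], []),
      ([Gen Z, Gen Z], []),
      ([Gen X, Gen Y], [Gen Y, Gen X]),
      ([Gen X, Gen Z], [Gen Z, Inv X]),
      ([Gen Y, Gen Z], [Gen Z, Inv Y])}"

lemma gen_dihedral_eq: "gen_dihedral_Z3_Z3 = presented_group relations"
  by (simp add: gen_dihedral_Z3_Z3_def relations_def)

lemma word_action_cong: "word_eq relations u v \<Longrightarrow> word_action u m = word_action v m"
proof (induction arbitrary: m rule: word_eq.induct)
  case (relation u v)
  obtain a b s where "m = ((a, b), s)" by (metis surj_pair)
  with relation show ?case by (auto simp: relations_def add.assoc)
next
  case (Gen_Inv x)
  then show ?case by (cases x; cases m) simp_all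
next
  case (Inv_Gen x)
  then show ?case by (cases x; cases m) simp_all
qed simp_all

fun normal_word :: "Z3_sq \<times> bool \<Rightarrow> generator word" where
  "normal_word ((i, j), s) =
     (if i = 0 then [] else if i = 1 then [Gen X] else [Gen X, Gen X]) @
     (if j = 0 then [] else if j = 1 then [Gen Y] else [Gen Y, Gen Y]) @
     (if s then [Gen Z] else [])"

definition element :: "Z3_sq \<times> bool \<Rightarrow> generator word set" where
  "element m = word_class relations (normal_word m)"

definition model_mult :: "Z3_sq \<times> bool \<Rightarrow> Z3_sq \<times> bool \<Rightarrow> Z3_sq \<times> bool" where
  "model_mult m m' = (fst m + (if snd m then - fst m' else fst m'), snd m \<noteq> snd m')"

lemma word_action_normal_word: "word_action (normal_word m) m' = model_mult m m'"
proof -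
  obtain i j s where m: "m = ((i, j), s)" by (metis surj_pair)
  obtain i' j' s' where m': "m' = ((i', j'), s')" by (metis surj_pair)
  show ?thesis
    using exhaust_Z3[of i] exhaust_Z3[of j]
    by (cases s) (auto simp: m m' model_mult_def algebra_simps)
qed

interpretation G: group gen_dihedral_Z3_Z3
  unfolding gen_dihedral_eq by (rule group_presented_group)

abbreviation dihedral_mult (infixl "\<cdot>" 70) where
  "a \<cdot> b \<equiv> a \<otimes>\<^bsub>gen_dihedral_Z3_Z3\<^esub> b"

lemma word_class_in_carrier [simp]: "word_class relations u \<in> carrier gen_dihedral_Z3_Z3"
  by (simp add: gen_dihedral_eq presented_group_def)

lemma word_class_append:
  "word_class relations (u @ v) = word_class relations u \<cdot> word_class relations v"
  by (simp add: gen_dihedral_eq presented_group_mult)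

lemma element_letter_action:
  "element (letter_action l m) = word_class relations [l] \<cdot> element m"
proof -
  let ?c = "word_class relations"
  define x y z where "x = ?c [Gen X]" and "y = ?c [Gen Y]" and "z = ?c [Gen Z]"
  have carr [simp]: "x \<in> carrier gen_dihedral_Z3_Z3" "y \<in> carrier gen_dihedral_Z3_Z3"
    "z \<in> carrier gen_dihedral_Z3_Z3"
    by (simp_all add: x_def y_def z_def)
  have Nil: "?c [] = \<one>\<^bsub>gen_dihedral_Z3_Z3\<^esub>"
    by (simp add: gen_dihedral_eq presented_group_def)
  have Cons: "?c (Gen X # u) = x \<cdot> ?c u" "?c (Gen Y # u) = y \<cdot> ?c u" "?c (Gen Z # u) = z \<cdot> ?c u" for u
    using word_class_append[of "[_]" u] by (simp_all add: x_def y_def z_def)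
  have rel: "?c u = ?c v" if "(u, v) \<in> relations" for u v
    using that by (simp add: word_class_eq_iff word_eq.relation)
  have inv: "?c [Inv g] = inv\<^bsub>gen_dihedral_Z3_Z3\<^esub> ?c [Gen g]" for g
    by (rule G.inv_equality[symmetric])
      (simp_all flip: word_class_append Nil add: word_class_eq_iff word_eq.Inv_Gen)
  have "?c [Gen X, Gen X, Gen X] = ?c []" "?c [Gen Y, Gen Y, Gen Y] = ?c []"
    "?c [Gen Z, Gen Z] = ?c []" "?c [Gen X, Gen Y] = ?c [Gen Y, Gen X]"
    and xz: "?c [Gen X, Gen Z] = ?c [Gen Z, Inv X]" and yz: "?c [Gen Y, Gen Z] = ?c [Gen Z, Inv Y]"
    by (rule rel; simp add: relations_def)+
  then have x3: "x \<cdot> (x \<cdot> x) = \<one>\<^bsub>gen_dihedral_Z3_Z3\<^esub>" and y3: "y \<cdot> (y \<cdot> y) = \<one>\<^bsub>gen_dihedral_Z3_Z3\<^esub>"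
    and z2: "z \<cdot> z = \<one>\<^bsub>gen_dihedral_Z3_Z3\<^esub>" and yx: "y \<cdot> x = x \<cdot> y"
    by (simp_all add: Cons Nil)
  have invs: "?c [Inv X] = x \<cdot> x" "?c [Inv Y] = y \<cdot> y" "?c [Inv Z] = z"
    unfolding inv x_def[symmetric] y_def[symmetric] z_def[symmetric]
    by (rule G.inv_equality; simp add: G.m_assoc x3 y3 z2)+
  have "x \<cdot> z = z \<cdot> (x \<cdot> x)" "y \<cdot> z = z \<cdot> (y \<cdot> y)"
    using xz yz by (simp_all add: Cons Nil invs)
  then have "x \<cdot> (x \<cdot> z) = z \<cdot> ((x \<cdot> (x \<cdot> x)) \<cdot> x)" "y \<cdot> (y \<cdot> z) = z \<cdot> ((y \<cdot> (y \<cdot> y)) \<cdot> y)"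
    by (metis G.m_assoc G.m_closed carr)+
  then have zx: "z \<cdot> x = x \<cdot> (x \<cdot> z)" and zy: "z \<cdot> y = y \<cdot> (y \<cdot> z)"
    by (simp_all add: x3 y3)
  have left: "a \<cdot> (b \<cdot> w) = c \<cdot> w"
    if "a \<cdot> b = c" "a \<in> carrier gen_dihedral_Z3_Z3" "b \<in> carrier gen_dihedral_Z3_Z3"
      "w \<in> carrier gen_dihedral_Z3_Z3" for a b c w
    using that by (simp add: G.m_assoc[symmetric])
  have rules: "x \<cdot> (x \<cdot> (x \<cdot> w)) = w" "y \<cdot> (y \<cdot> (y \<cdot> w)) = w" "z \<cdot> (z \<cdot> w) = w"
    "y \<cdot> (x \<cdot> w) = x \<cdot> (y \<cdot> w)" "z \<cdot> (x \<cdot> w) = x \<cdot> (x \<cdot> (z \<cdot> w))"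
    "z \<cdot> (y \<cdot> w) = y \<cdot> (y \<cdot> (z \<cdot> w))"
    if "w \<in> carrier gen_dihedral_Z3_Z3" for w
    using left[OF z2, of w] left[OF yx, of w] left[OF zx, of w] left[OF zy, of w] that
      left[OF x3, of w] left[OF y3, of w]
    by (simp_all add: G.m_assoc)
  note rules = rules x3 y3 z2 yx zx zy
  obtain i j s where m: "m = ((i, j), s)" by (metis surj_pair)
  note eval = zero_prod_def element_def Cons Nil invs rules G.m_assoc
  have letters: "l \<in> {Gen X, Gen Y, Gen Z, Inv X, Inv Y, Inv Z}"
  proof (cases l)
    case (Gen g)
    then show ?thesis by (cases g) auto
  next
    case (Inv g)
    then show ?thesis by (cases g) auto
  qed
  have "i = 0 \<or> i = 1 \<or> i = 2" "j = 0 \<or> j = 1 \<or> j = 2" by (rule exhaust_Z3)+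
  with letters show ?thesis
    unfolding m insert_iff empty_iff
    by (elim disjE FalseE; cases s; hypsubst) (simp_all add: eval)
qed

lemma element_word_action:
  "element (word_action u ((0, 0), False)) = word_class relations u"
proof (induction u)
  case Nil
  show ?case by (simp add: element_def)
next
  case (Cons l u)
  then show ?case
    using word_class_append[of "[l]" u] by (simp add: element_letter_action)
qed

lemma element_mult:
  "element m \<cdot> element m' = element (model_mult m m')"
proof -
  have "element m \<cdot> element m'
      = element (word_action (normal_word m @ normal_word m') ((0, 0), False))"
    unfolding element_word_action by (simp add: element_def word_class_append)
  also have "word_action (normal_word m @ normal_word m') ((0, 0), False) = model_mult m m'"
    by (simp add: word_action_normal_word) (simp add: model_mult_def flip: zero_prod_def)
  finally show ?thesis .
qed

lemma bij_element: "bij_betw element UNIV (carrier gen_dihedral_Z3_Z3)"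
proof (rule bij_betwI')
  fix m m'
  have "model_mult m ((0, 0), False) = model_mult m' ((0, 0), False)" if "element m = element m'"
    using word_action_cong[of "normal_word m" "normal_word m'" "((0, 0), False)"] that
    by (simp add: element_def word_class_eq_iff word_action_normal_word)
  moreover have "model_mult m ((0, 0), False) = m" for m
    by (simp add: model_mult_def prod_eq_iff)
  ultimately show "(element m = element m') = (m = m')"
    by metis
  show "element m \<in> carrier gen_dihedral_Z3_Z3"
    by (simp add: element_def)
next
  fix c assume "c \<in> carrier gen_dihedral_Z3_Z3"
  then obtain u where "c = word_class relations u"
    by (auto simp: gen_dihedral_eq presented_group_def)
  then show "\<exists>m\<in>UNIV. c = element m"
    using element_word_action[of u, symmetric] by (metis UNIV_I)
qed

lemma inv_element:
  "inv\<^bsub>gen_dihedral_Z3_Z3\<^esub> element (a, s) = element (if s then a else - a, s)"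
proof (rule G.inv_equality)
  have "element ((0, 0), False) = \<one>\<^bsub>gen_dihedral_Z3_Z3\<^esub>"
    by (simp add: element_def gen_dihedral_eq presented_group_def)
  then show "element (if s then a else - a, s) \<cdot> element (a, s)
      = \<one>\<^bsub>gen_dihedral_Z3_Z3\<^esub>"
    by (simp add: element_mult) (simp add: model_mult_def zero_prod_def)
qed (simp_all add: element_def)

definition Z3_sq_enum :: "nat \<Rightarrow> Z3_sq" where
  "Z3_sq_enum i = (of_nat (i div 3), of_nat (i mod 3))"

lemma bij_Z3_sq_enum: "bij_betw Z3_sq_enum {0..<9} UNIV"
proof -
  have "Z3_sq_enum ` {0..<9} = UNIV"
    unfolding UNIV_Z3_sq by (simp add: Z3_sq_enum_def atLeastLessThan_nat_numeral insert_commute)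
  then show ?thesis
    by (intro bij_betw_imageI) (simp_all add: eq_card_imp_inj_on)
qed

text \<open>Listing \<open>aZ\<close> in the order of the inverses \<open>a\<^sup>-\<^sup>1\<close> turns all four blocks of the group matrix
  into (transposed) difference matrices, which commute.\<close>

lemma group_det_gen_dihedral:
  "group_det gen_dihedral_Z3_Z3 c = det (difference_matrix 9 Z3_sq_enum
     (\<lambda>x. autocorrelation (\<lambda>a. c (element (a, False))) x
        - autocorrelation (\<lambda>a. c (element (a, True))) x))"
proof -
  define m where "m i = (if i < 9 then (Z3_sq_enum i, False) else (- Z3_sq_enum (i - 9), True))" for i
  have card: "card (carrier gen_dihedral_Z3_Z3) = 18"
    using bij_betw_same_card[OF bij_element] by simp
  have "m ` {0..<18} = UNIV"
  proof (intro equalityI subset_UNIV subsetI)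
    fix q :: "Z3_sq \<times> bool"
    obtain a s where q: "q = (a, s)" by (metis surj_pair)
    obtain i where i: "i < 9" "Z3_sq_enum i = (if s then - a else a)"
      using bij_Z3_sq_enum unfolding bij_betw_def by (metis UNIV_I atLeastLessThan_iff imageE)
    show "q \<in> m ` {0..<18}"
      by (rule image_eqI[where x = "if s then i + 9 else i"]) (use i in \<open>auto simp: q m_def\<close>)
  qed
  then have "bij_betw m {0..<18} UNIV"
    by (intro bij_betw_imageI) (simp_all add: eq_card_imp_inj_on)
  then have e: "bij_betw (element \<circ> m) {0..<card (carrier gen_dihedral_Z3_Z3)} (carrier gen_dihedral_Z3_Z3)"
    unfolding card using bij_element by (rule bij_betw_trans)
  let ?D = "difference_matrix 9 Z3_sq_enum"
  let ?f = "\<lambda>a. c (element (a, False))" and ?g = "\<lambda>a. c (element (a, True))"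
  have "group_matrix gen_dihedral_Z3_Z3 (element \<circ> m) c
      = four_block_mat (?D ?f) (?D ?g) (?D ?g)\<^sup>T (?D ?f)\<^sup>T"
    unfolding transpose_difference_matrix
    by (rule eq_matI)
      (auto simp: group_matrix_def card difference_matrix_def four_block_mat_def Let_def m_def
        inv_element element_mult model_mult_def)
  then show ?thesis
    by (simp add: group_det_eq[OF e] det_dihedral_block[OF bij_Z3_sq_enum])
qed

section \<open>Diagonalization\<close>

definition lines_sum :: "(Z3_sq \<Rightarrow> int) \<Rightarrow> int" where
  "lines_sum h = h (1, 0) + h (0, 1) + h (1, 1) + h (1, 2)"

text \<open>Each \<open>line_form k\<close> is a linear functional whose kernel is the line spanned by \<open>line_gen k\<close>.
  \<open>eigenvector (2 * k + 1)\<close> and \<open>eigenvector (2 * k + 2)\<close> span over \<open>\<rat>\<close> the functions of \<open>line_form k\<close> with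
  sum zero, an integral substitute for the two complex conjugate characters that are trivial on that
  line.\<close>

fun line_form :: "nat \<Rightarrow> Z3_sq \<Rightarrow> 3" where
  "line_form k (i, j) = (if k = 0 then j else if k = 1 then i else if k = 2 then i - j else i + j)"

fun line_gen :: "nat \<Rightarrow> Z3_sq" where
  "line_gen k = (if k = 0 then (1, 0) else if k = 1 then (0, 1) else if k = 2 then (1, 1) else (1, 2))"

definition eigenvector :: "nat \<Rightarrow> Z3_sq \<Rightarrow> int" where
  "eigenvector j x = (if j = 0 then 1 else
     let a = line_form ((j - 1) div 2) x in
     if odd j then (if a = 0 then 1 else if a = 1 then - 1 else 0)
     else (if a = 0 then 0 else if a = 1 then 1 else - 1))"

definition dual_eigenvector :: "nat \<Rightarrow> Z3_sq \<Rightarrow> int" where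
  "dual_eigenvector j x = (if j = 0 then 1 else
     let a = line_form ((j - 1) div 2) x in
     if odd j then (if a = 0 then 2 else - 1)
     else (if a = 2 then - 2 else 1))"

definition eigenvalue :: "(Z3_sq \<Rightarrow> int) \<Rightarrow> nat \<Rightarrow> int" where
  "eigenvalue h j = (if j = 0 then h (0, 0) + 2 * lines_sum h
     else h (0, 0) - lines_sum h + 3 * h (line_gen ((j - 1) div 2)))"

lemma less_9_cases: "j < 9 \<Longrightarrow> j \<in> {0, 1, 2, 3, 4, 5, 6, 7, 8}" for j :: nat
  by auto

lemma eigenvector_convolution:
  assumes "\<And>x. h (- x) = h x" and j: "j < 9"
  shows "(\<Sum>y\<in>UNIV. h (x - y) * eigenvector j y) = eigenvalue h j * eigenvector j x"
proof -
  have even: "h (0, 2) = h (0, 1)" "h (2, 0) = h (1, 0)" "h (2, 1) = h (1, 2)" "h (2, 2) = h (1, 1)"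
    using assms(1)[of "(0, 1)"] assms(1)[of "(1, 0)"] assms(1)[of "(1, 2)"] assms(1)[of "(1, 1)"]
    by simp_all
  have "x \<in> UNIV" by simp
  with less_9_cases[OF j] show ?thesis
    unfolding sum_Z3_sq UNIV_Z3_sq insert_iff empty_iff
    by (elim disjE FalseE; hypsubst)
      (simp_all add: eigenvector_def eigenvalue_def lines_sum_def even zero_prod_def)
qed

lemma dual_eigenvector_orthogonal:
  assumes "i < 9" "j < 9"
  shows "(\<Sum>y\<in>UNIV. dual_eigenvector i y * eigenvector j y) = (if i = j then 9 else 0)"
  using less_9_cases[OF assms(1)] less_9_cases[OF assms(2)]
  unfolding sum_Z3_sq insert_iff empty_iff
  by (elim disjE FalseE; hypsubst) (simp_all add: eigenvector_def dual_eigenvector_def)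

lemma det_diagonal:
  "det (mat n n (\<lambda>(i, j). if i = j then d i else 0)) = (\<Prod>i = 0..<n. d i)" for d :: "nat \<Rightarrow> int"
proof -
  have "det (mat n n (\<lambda>(i, j). if i = j then d i else 0))
      = prod_list (diag_mat (mat n n (\<lambda>(i, j). if i = j then d i else 0)))"
    by (rule det_lower_triangular[where n = n]) auto
  also have "diag_mat (mat n n (\<lambda>(i, j). if i = j then d i else 0)) = map d [0..<n]"
    by (auto simp: diag_mat_def)
  finally show ?thesis
    by (simp add: prod.distinct_set_conv_list[symmetric])
qed

lemma det_even_difference_matrix:
  assumes even: "\<And>x. h (- x) = h x"
  shows "det (difference_matrix 9 Z3_sq_enum h) = (h (0, 0) + 2 * lines_sum h) *
    ((h (0, 0) - lines_sum h + 3 * h (1, 0)) * (h (0, 0) - lines_sum h + 3 * h (0, 1)) *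
     (h (0, 0) - lines_sum h + 3 * h (1, 1)) * (h (0, 0) - lines_sum h + 3 * h (1, 2)))\<^sup>2"
proof -
  let ?p = Z3_sq_enum
  define W where "W = mat 9 9 (\<lambda>(i, j). eigenvector j (?p i))"
  define V where "V = mat 9 9 (\<lambda>(i, j). dual_eigenvector i (?p j))"
  define D where "D = mat 9 9 (\<lambda>(i, j). if i = j then eigenvalue h i else 0)"
  let ?H = "difference_matrix 9 Z3_sq_enum h"
  have carr: "W \<in> carrier_mat 9 9" "V \<in> carrier_mat 9 9" "D \<in> carrier_mat 9 9"
    "?H \<in> carrier_mat 9 9"
    by (simp_all add: W_def V_def D_def)
  have sum: "(\<Sum>k = 0..<9. F (?p k)) = (\<Sum>y\<in>UNIV. F y)" for F :: "Z3_sq \<Rightarrow> int"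
    by (rule sum.reindex_bij_betw[OF bij_Z3_sq_enum])
  have "?H * W = W * D"
  proof (rule eq_matI)
    fix i j assume "i < dim_row (W * D)" "j < dim_col (W * D)"
    then have ij: "i < 9" "j < 9" by (simp_all add: W_def D_def)
    have "(?H * W) $$ (i, j) = (\<Sum>k = 0..<9. h (?p i - ?p k) * eigenvector j (?p k))"
      using ij by (simp add: difference_matrix_def W_def scalar_prod_def)
    also have "\<dots> = eigenvalue h j * eigenvector j (?p i)"
      unfolding sum[of "\<lambda>y. h (?p i - y) * eigenvector j y"]
      by (rule eigenvector_convolution[where h = h, OF even ij(2)])
    also have "\<dots> = (W * D) $$ (i, j)"
      using ij by (simp add: D_def W_def scalar_prod_def if_distrib cong: if_cong)
    finally show "(?H * W) $$ (i, j) = (W * D) $$ (i, j)" .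
  qed (simp_all add: W_def D_def difference_matrix_def)
  then have eq: "det ?H * det W = det W * det D"
    using carr by (metis det_mult)
  have "V * W = mat 9 9 (\<lambda>(i, j). if i = j then 9 else 0)"
  proof (rule eq_matI)
    fix i j assume "i < dim_row (mat 9 9 (\<lambda>(i, j). if i = j then 9 else 0 :: int))"
      "j < dim_col (mat 9 9 (\<lambda>(i, j). if i = j then 9 else 0 :: int))"
    then have ij: "i < 9" "j < 9" by simp_all
    then have "(V * W) $$ (i, j) = (\<Sum>k = 0..<9. dual_eigenvector i (?p k) * eigenvector j (?p k))"
      by (simp add: V_def W_def scalar_prod_def)
    with ij show "(V * W) $$ (i, j) = mat 9 9 (\<lambda>(i, j). if i = j then 9 else 0) $$ (i, j)"
      by (simp add: sum[of "\<lambda>y. dual_eigenvector i y * eigenvector j y"]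
          dual_eigenvector_orthogonal)
  qed (simp_all add: V_def W_def)
  then have "det V * det W = 9 ^ 9"
    using carr by (simp add: det_diagonal flip: det_mult)
  then have "det W \<noteq> 0" by auto
  with eq have "det ?H = det D" by simp
  also have "\<dots> = (\<Prod>i = 0..<9. eigenvalue h i)"
    unfolding D_def by (rule det_diagonal)
  finally show ?thesis
    by (simp add: eigenvalue_def atLeastLessThan_nat_numeral power2_eq_square mult_ac)
qed

definition dihedral_norm :: "(Z3_sq \<Rightarrow> int) \<Rightarrow> (Z3_sq \<Rightarrow> int) \<Rightarrow> Z3_sq \<Rightarrow> int" where
  "dihedral_norm f g x = autocorrelation f x - autocorrelation g x"

definition line_factor :: "(Z3_sq \<Rightarrow> int) \<Rightarrow> Z3_sq \<Rightarrow> int" where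
  "line_factor h x = h (0, 0) - lines_sum h + 3 * h x"

definition line_factors :: "(Z3_sq \<Rightarrow> int) \<Rightarrow> int" where
  "line_factors h = line_factor h (1, 0) * line_factor h (0, 1) * line_factor h (1, 1) * line_factor h (1, 2)"

definition dihedral_det :: "(Z3_sq \<Rightarrow> int) \<Rightarrow> (Z3_sq \<Rightarrow> int) \<Rightarrow> int" where
  "dihedral_det f g =
     (sum f UNIV - sum g UNIV) * (sum f UNIV + sum g UNIV) * (line_factors (dihedral_norm f g))\<^sup>2"

lemma dihedral_norm_uminus: "dihedral_norm f g (- x) = dihedral_norm f g x"
  by (simp add: dihedral_norm_def autocorrelation_uminus)

lemma sum_dihedral_norm:
  "dihedral_norm f g (0, 0) + 2 * lines_sum (dihedral_norm f g)
    = (sum f UNIV - sum g UNIV) * (sum f UNIV + sum g UNIV)"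
proof -
  let ?h = "dihedral_norm f g"
  have "sum ?h UNIV = (sum f UNIV - sum g UNIV) * (sum f UNIV + sum g UNIV)"
    by (simp add: dihedral_norm_def sum_subtractf sum_autocorrelation power2_eq_square algebra_simps)
  moreover have "?h (0, 2) = ?h (0, 1)" "?h (2, 0) = ?h (1, 0)" "?h (2, 1) = ?h (1, 2)"
    "?h (2, 2) = ?h (1, 1)"
    using dihedral_norm_uminus[of f g "(0, 1)"] dihedral_norm_uminus[of f g "(1, 0)"]
      dihedral_norm_uminus[of f g "(1, 2)"] dihedral_norm_uminus[of f g "(1, 1)"]
    by simp_all
  then have "sum ?h UNIV = ?h (0, 0) + 2 * lines_sum ?h"
    unfolding sum_Z3_sq lines_sum_def by simp
  ultimately show ?thesis by simp
qed

lemma group_det_eq_dihedral_det: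
  "group_det gen_dihedral_Z3_Z3 c
    = dihedral_det (\<lambda>a. c (element (a, False))) (\<lambda>a. c (element (a, True)))"
  unfolding group_det_gen_dihedral dihedral_norm_def[symmetric]
    det_even_difference_matrix[where h = "dihedral_norm _ _", OF dihedral_norm_uminus] sum_dihedral_norm
  by (simp add: dihedral_det_def line_factors_def line_factor_def)

lemma integer_group_dets_eq:
  "integer_group_dets gen_dihedral_Z3_Z3 = {dihedral_det f g | f g. True}"
proof (intro equalityI subsetI)
  fix d assume "d \<in> {dihedral_det f g | f g. True}"
  then obtain f g where d: "d = dihedral_det f g" by blast
  define c where "c A = (if A \<in> carrier gen_dihedral_Z3_Z3
    then case inv_into UNIV element A of (a, s) \<Rightarrow> if s then g a else f a else 0)" for A
  have "c (element (a, s)) = (if s then g a else f a)" for a s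
    using bij_element by (simp add: c_def bij_betw_def inv_into_f_f image_iff) blast
  then have "group_det gen_dihedral_Z3_Z3 c = d"
    by (simp add: group_det_eq_dihedral_det d)
  moreover have "finite (carrier gen_dihedral_Z3_Z3)"
    using bij_betw_finite[OF bij_element] by simp
  then have "c \<in> integral_group_ring gen_dihedral_Z3_Z3"
    by (auto simp: integral_group_ring_def c_def intro: finite_subset)
  ultimately show "d \<in> integer_group_dets gen_dihedral_Z3_Z3"
    by (auto simp: integer_group_dets_def)
qed (auto simp: integer_group_dets_def group_det_eq_dihedral_det)

section \<open>Necessary conditions\<close>

text \<open>All nine factors are congruent modulo 3 to \<open>t = h 0 - lines_sum h\<close>, and the offsets of the four
  squared ones add up to that of the first: this is what pins the determinant modulo 9.\<close>

lemma dihedral_det_factors: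
  obtains t c\<^sub>1 c\<^sub>2 c\<^sub>3 c\<^sub>4 where
    "dihedral_det f g = (t + 3 * (c\<^sub>1 + c\<^sub>2 + c\<^sub>3 + c\<^sub>4)) *
       ((t + 3 * c\<^sub>1) * (t + 3 * c\<^sub>2) * (t + 3 * c\<^sub>3) * (t + 3 * c\<^sub>4))\<^sup>2"
proof -
  let ?h = "dihedral_norm f g"
  have eq: "(sum f UNIV - sum g UNIV) * (sum f UNIV + sum g UNIV)
      = ?h (0, 0) - lines_sum ?h + 3 * (?h (1, 0) + ?h (0, 1) + ?h (1, 1) + ?h (1, 2))"
    using sum_dihedral_norm[of f g] by (simp add: lines_sum_def)
  show ?thesis
    by (rule that[of "?h (0, 0) - lines_sum ?h"])
      (unfold dihedral_det_def line_factors_def line_factor_def eq, rule HOL.refl)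
qed

lemma three_dvd_dihedral_det:
  assumes "3 dvd dihedral_det f g"
  shows "3 ^ 9 dvd dihedral_det f g"
proof -
  obtain t c\<^sub>1 c\<^sub>2 c\<^sub>3 c\<^sub>4 where d: "dihedral_det f g = (t + 3 * (c\<^sub>1 + c\<^sub>2 + c\<^sub>3 + c\<^sub>4)) *
       ((t + 3 * c\<^sub>1) * (t + 3 * c\<^sub>2) * (t + 3 * c\<^sub>3) * (t + 3 * c\<^sub>4))\<^sup>2"
    by (rule dihedral_det_factors)
  have prime: "prime (3 :: int)" by simp
  have "3 dvd t + 3 * c \<longleftrightarrow> 3 dvd t" for c :: int by presburger
  with assms have "3 dvd t"
    unfolding d by (auto simp only: prime_dvd_mult_iff[OF prime] prime_dvd_power_iff[OF prime]
      prime_dvd_power_int_iff[OF prime])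
  then obtain s where t: "t = 3 * s" by blast
  have "dihedral_det f g = 3 ^ 9 * ((s + (c\<^sub>1 + c\<^sub>2 + c\<^sub>3 + c\<^sub>4)) *
       ((s + c\<^sub>1) * (s + c\<^sub>2) * (s + c\<^sub>3) * (s + c\<^sub>4))\<^sup>2)"
    unfolding d t distrib_left[symmetric] power_mult_distrib by simp
  then show ?thesis by simp
qed

lemma cube_mod_9: "\<not> 3 dvd t \<Longrightarrow> [t ^ 3 = 1] (mod 9) \<or> [t ^ 3 = - 1] (mod 9)" for t :: int
proof -
  assume "\<not> 3 dvd t"
  then have "t mod 9 \<in> {1, 2, 4, 5, 7, 8}" by auto presburger
  then have "(t mod 9) ^ 3 mod 9 \<in> {1, 8}" by auto
  then show ?thesis by (simp add: cong_def power_mod)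
qed

lemma dihedral_det_mod_9:
  assumes "\<not> 3 dvd dihedral_det f g"
  shows "[dihedral_det f g = 1] (mod 9) \<or> [dihedral_det f g = - 1] (mod 9)"
proof -
  obtain t c\<^sub>1 c\<^sub>2 c\<^sub>3 c\<^sub>4 where d: "dihedral_det f g = (t + 3 * (c\<^sub>1 + c\<^sub>2 + c\<^sub>3 + c\<^sub>4)) *
       ((t + 3 * c\<^sub>1) * (t + 3 * c\<^sub>2) * (t + 3 * c\<^sub>3) * (t + 3 * c\<^sub>4))\<^sup>2"
    by (rule dihedral_det_factors)
  define S where "S = c\<^sub>1 + c\<^sub>2 + c\<^sub>3 + c\<^sub>4"
  define Q where "Q = t ^ 4 + 3 * t ^ 3 * S"
  have pair: "[(a + 3 * b) * (a' + 3 * b') = a * a' + 3 * (a * b' + a' * b)] (mod 9)"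
    for a b a' b' :: int
    by (simp add: cong_iff_dvd_diff algebra_simps)
  have "[(t + 3 * c\<^sub>1) * (t + 3 * c\<^sub>2) * ((t + 3 * c\<^sub>3) * (t + 3 * c\<^sub>4))
      = (t * t + 3 * (t * c\<^sub>2 + t * c\<^sub>1)) * (t * t + 3 * (t * c\<^sub>4 + t * c\<^sub>3))] (mod 9)"
    by (intro cong_mult pair)
  also have "[(t * t + 3 * (t * c\<^sub>2 + t * c\<^sub>1)) * (t * t + 3 * (t * c\<^sub>4 + t * c\<^sub>3))
      = t * t * (t * t) + 3 * (t * t * (t * c\<^sub>4 + t * c\<^sub>3) + t * t * (t * c\<^sub>2 + t * c\<^sub>1))] (mod 9)"
    by (rule pair)
  also have "t * t * (t * t) + 3 * (t * t * (t * c\<^sub>4 + t * c\<^sub>3) + t * t * (t * c\<^sub>2 + t * c\<^sub>1)) = Q"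
    by (simp add: Q_def S_def power_numeral_reduce algebra_simps)
  finally have "[dihedral_det f g = (t + 3 * S) * Q\<^sup>2] (mod 9)"
    unfolding d S_def by (intro cong_mult cong_pow cong_refl) (simp add: mult.assoc)
  also have "(t + 3 * S) * Q\<^sup>2 = t ^ 9 + 9 * (t ^ 8 * S + 3 * t ^ 7 * S\<^sup>2 + 3 * t ^ 6 * S ^ 3)"
    by (simp add: Q_def power_numeral_reduce algebra_simps)
  also have "[t ^ 9 + 9 * (t ^ 8 * S + 3 * t ^ 7 * S\<^sup>2 + 3 * t ^ 6 * S ^ 3) = t ^ 9] (mod 9)"
    by (simp add: cong_iff_dvd_diff)
  finally have *: "[dihedral_det f g = (t ^ 3) ^ 3] (mod 9)"
    by simp
  have "\<not> 3 dvd t"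
  proof
    assume "3 dvd t"
    then have "3 dvd t + 3 * S" by simp
    with assms show False unfolding d S_def by (simp add: dvd_mult2)
  qed
  then consider "[t ^ 3 = 1] (mod 9)" | "[t ^ 3 = - 1] (mod 9)"
    using cube_mod_9 by blast
  then show ?thesis
  proof cases
    case 1
    from cong_trans[OF * cong_pow[OF this]] show ?thesis by simp
  next
    case 2
    from cong_trans[OF * cong_pow[OF this]] show ?thesis by simp
  qed
qed

lemma two_dvd_dihedral_det:
  assumes "2 dvd dihedral_det f g"
  shows "4 dvd dihedral_det f g"
proof -
  let ?u = "sum f UNIV - sum g UNIV" and ?v = "sum f UNIV + sum g UNIV"
  let ?P = "line_factors (dihedral_norm f g)"
  consider "2 dvd ?u" "2 dvd ?v" | "2 dvd ?P"
    using assms by (auto simp: dihedral_det_def)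
  then have "2 * 2 dvd ?u * ?v * ?P\<^sup>2"
  proof cases
    case 1
    then show ?thesis by (intro dvd_mult2 mult_dvd_mono)
  next
    case 2
    then show ?thesis unfolding power2_eq_square by (intro dvd_mult mult_dvd_mono)
  qed
  then show ?thesis by (simp add: dihedral_det_def)
qed

section \<open>Realization\<close>

lemma dihedral_det_swap: "dihedral_det g f = - dihedral_det f g"
proof -
  have "dihedral_norm g f = (\<lambda>x. - dihedral_norm f g x)"
    by (simp add: dihedral_norm_def fun_eq_iff)
  then have "line_factors (dihedral_norm g f) = line_factors (dihedral_norm f g)"
    by (simp add: line_factors_def line_factor_def lines_sum_def algebra_simps)
  then show ?thesis
    by (simp add: dihedral_det_def algebra_simps)
qed

lemma integer_group_dets_uminus:
  "d \<in> integer_group_dets gen_dihedral_Z3_Z3 \<Longrightarrow> - d \<in> integer_group_dets gen_dihedral_Z3_Z3"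
  unfolding integer_group_dets_eq mem_Collect_eq by (metis dihedral_det_swap)

lemma dihedral_det_shift:
  "dihedral_det (\<lambda>x. f x + k) (\<lambda>x. g x + k) = (sum f UNIV - sum g UNIV) *
     (sum f UNIV + sum g UNIV + 18 * k) * (line_factors (dihedral_norm f g))\<^sup>2"
proof -
  have sum_shift: "sum (\<lambda>x. f x + k) UNIV = sum f UNIV + 9 * k" for f :: "Z3_sq \<Rightarrow> int"
    by (simp add: sum.distrib)
  have translate: "(\<Sum>y\<in>UNIV. f (x + y)) = sum f UNIV" for f :: "Z3_sq \<Rightarrow> int" and x
    by (rule sum.reindex_bij_witness[where i = "\<lambda>y. y - x" and j = "\<lambda>y. x + y"]) auto
  have "autocorrelation (\<lambda>x. f x + k) x = autocorrelation f x + 2 * k * sum f UNIV + 9 * k\<^sup>2"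
    for f :: "Z3_sq \<Rightarrow> int" and x
    using translate[of f x]
    by (simp add: autocorrelation_def algebra_simps sum.distrib power2_eq_square
        flip: sum_distrib_left)
  then have "dihedral_norm (\<lambda>x. f x + k) (\<lambda>x. g x + k)
      = (\<lambda>x. dihedral_norm f g x + 2 * k * (sum f UNIV - sum g UNIV))"
    by (simp add: dihedral_norm_def fun_eq_iff algebra_simps)
  then have "line_factor (dihedral_norm (\<lambda>x. f x + k) (\<lambda>x. g x + k)) = line_factor (dihedral_norm f g)"
    by (simp add: line_factor_def lines_sum_def fun_eq_iff)
  then show ?thesis
    by (simp add: dihedral_det_def line_factors_def sum_shift)
qed

lemma shifted_det_in_integer_group_dets:
  assumes "sum f UNIV = a" "sum g UNIV = b"
    and "dihedral_norm f g (0, 0) = n\<^sub>0" "dihedral_norm f g (1, 0) = n\<^sub>1"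
      "dihedral_norm f g (0, 1) = n\<^sub>2" "dihedral_norm f g (1, 1) = n\<^sub>3"
      "dihedral_norm f g (1, 2) = n\<^sub>4"
    and t: "t = n\<^sub>0 - (n\<^sub>1 + n\<^sub>2 + n\<^sub>3 + n\<^sub>4)"
  shows "(a - b) * (a + b + 18 * k) *
    ((t + 3 * n\<^sub>1) * (t + 3 * n\<^sub>2) * (t + 3 * n\<^sub>3) * (t + 3 * n\<^sub>4))\<^sup>2
      \<in> integer_group_dets gen_dihedral_Z3_Z3"
proof -
  have "dihedral_det (\<lambda>x. f x + k) (\<lambda>x. g x + k) = (a - b) * (a + b + 18 * k) *
    ((t + 3 * n\<^sub>1) * (t + 3 * n\<^sub>2) * (t + 3 * n\<^sub>3) * (t + 3 * n\<^sub>4))\<^sup>2"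
    unfolding dihedral_det_shift line_factors_def line_factor_def lines_sum_def assms by (rule HOL.refl)
  then show ?thesis
    unfolding integer_group_dets_eq by (metis (mono_tags, lifting) mem_Collect_eq)
qed

definition Z3_index :: "3 \<Rightarrow> nat" where
  "Z3_index i = (if i = 0 then 0 else if i = 1 then 1 else 2)"

definition grid :: "int list list \<Rightarrow> Z3_sq \<Rightarrow> int" where
  "grid xss x = xss ! Z3_index (fst x) ! Z3_index (snd x)"

lemma Z3_index_simps: "Z3_index 0 = 0" "Z3_index 1 = 1" "Z3_index 2 = 2"
  by (simp_all add: Z3_index_def)

lemma Z3_numeral_reduce: "(3 :: 3) = 0" "(4 :: 3) = 1"
  by simp_all

lemmas evaluate_grid = sum_Z3_sq dihedral_norm_def autocorrelation_def grid_def Z3_index_simps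
  Z3_numeral_reduce

text \<open>The witnesses were found by a computer search over coefficients in \<open>{-1, 0, 1}\<close>.\<close>

lemma dets_1_mod_18: "1 + 18 * k \<in> integer_group_dets gen_dihedral_Z3_Z3"
proof -
  let ?f = "grid [[1, 0, 0], [0, 0, 0], [0, 0, 0]]"
  let ?g = "grid [[0, 0, 0], [0, 0, 0], [0, 0, 0]]"
  have "sum ?f UNIV = 1" "sum ?g UNIV = 0"
    "dihedral_norm ?f ?g (0, 0) = 1" "dihedral_norm ?f ?g (1, 0) = 0"
    "dihedral_norm ?f ?g (0, 1) = 0" "dihedral_norm ?f ?g (1, 1) = 0"
    "dihedral_norm ?f ?g (1, 2) = 0"
    by (simp_all add: evaluate_grid)
  from shifted_det_in_integer_group_dets[OF this HOL.refl, of k] show ?thesis by simp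
qed

lemma dets_8_mod_36: "8 + 36 * k \<in> integer_group_dets gen_dihedral_Z3_Z3"
proof -
  let ?f = "grid [[0, 0, 0], [0, 0, 1], [0, 1, 1]]"
  let ?g = "grid [[0, 0, 1], [1, 0, 0], [0, - 1, 0]]"
  have "sum ?f UNIV = 3" "sum ?g UNIV = 1"
    "dihedral_norm ?f ?g (0, 0) = 0" "dihedral_norm ?f ?g (1, 0) = 1"
    "dihedral_norm ?f ?g (0, 1) = 1" "dihedral_norm ?f ?g (1, 1) = 1"
    "dihedral_norm ?f ?g (1, 2) = 1"
    by (simp_all add: evaluate_grid)
  from shifted_det_in_integer_group_dets[OF this HOL.refl, of k] show ?thesis by simp
qed

lemma dets_even_0_mod_3: "2 * (18 * k) * 3 ^ 8 \<in> integer_group_dets gen_dihedral_Z3_Z3"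
proof -
  let ?f = "grid [[0, 0, 0], [0, 0, 0], [1, 1, - 1]]"
  let ?g = "grid [[0, 0, 1], [0, 0, - 1], [- 1, 0, 0]]"
  have "sum ?f UNIV = 1" "sum ?g UNIV = - 1"
    "dihedral_norm ?f ?g (0, 0) = 0" "dihedral_norm ?f ?g (1, 0) = 1"
    "dihedral_norm ?f ?g (0, 1) = - 1" "dihedral_norm ?f ?g (1, 1) = - 1"
    "dihedral_norm ?f ?g (1, 2) = 1"
    by (simp_all add: evaluate_grid)
  from shifted_det_in_integer_group_dets[OF this HOL.refl, of k] show ?thesis by simp
qed

lemma dets_even_1_mod_3: "2 * (6 + 18 * k) * 3 ^ 8 \<in> integer_group_dets gen_dihedral_Z3_Z3"
proof -
  let ?f = "grid [[0, 0, 0], [0, 1, 1], [0, 1, 1]]"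
  let ?g = "grid [[0, 0, 1], [0, 0, 1], [1, - 1, 0]]"
  have "sum ?f UNIV = 4" "sum ?g UNIV = 2"
    "dihedral_norm ?f ?g (0, 0) = 0" "dihedral_norm ?f ?g (1, 0) = 1"
    "dihedral_norm ?f ?g (0, 1) = 3" "dihedral_norm ?f ?g (1, 1) = 1"
    "dihedral_norm ?f ?g (1, 2) = 1"
    by (simp_all add: evaluate_grid)
  from shifted_det_in_integer_group_dets[OF this HOL.refl, of k] show ?thesis by simp
qed

lemma dets_odd_9_mod_18: "(9 + 18 * k) * 3 ^ 8 \<in> integer_group_dets gen_dihedral_Z3_Z3"
proof -
  let ?f = "grid [[0, 0, 1], [0, 0, 1], [1, 1, 1]]"
  let ?g = "grid [[0, 0, 1], [0, 0, 1], [1, 1, 0]]"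
  have "sum ?f UNIV = 5" "sum ?g UNIV = 4"
    "dihedral_norm ?f ?g (0, 0) = 1" "dihedral_norm ?f ?g (1, 0) = 2"
    "dihedral_norm ?f ?g (0, 1) = 2" "dihedral_norm ?f ?g (1, 1) = 0"
    "dihedral_norm ?f ?g (1, 2) = 0"
    by (simp_all add: evaluate_grid)
  from shifted_det_in_integer_group_dets[OF this HOL.refl, of k] show ?thesis by simp
qed

lemma dets_odd_3_mod_18: "(3 + 18 * k) * 3 ^ 8 \<in> integer_group_dets gen_dihedral_Z3_Z3"
proof -
  let ?f = "grid [[0, 0, 0], [0, 0, 0], [0, 1, 1]]"
  let ?g = "grid [[0, 0, 0], [0, 0, 0], [1, 1, - 1]]"
  have "sum ?f UNIV = 2" "sum ?g UNIV = 1"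
    "dihedral_norm ?f ?g (0, 0) = - 1" "dihedral_norm ?f ?g (1, 0) = 0"
    "dihedral_norm ?f ?g (0, 1) = 2" "dihedral_norm ?f ?g (1, 1) = 0"
    "dihedral_norm ?f ?g (1, 2) = 0"
    by (simp_all add: evaluate_grid)
  from shifted_det_in_integer_group_dets[OF this HOL.refl, of k] show ?thesis by simp
qed

lemma mod_3_cases:
  fixes m :: int
  obtains k where "m = 3 * k" | k where "m = 3 * k + 1" | k where "m = - (3 * k + 1)"
proof -
  have "m = 3 * (m div 3) \<or> m = 3 * (m div 3) + 1 \<or> m = - (3 * (- (m div 3) - 1) + 1)"
    by presburger
  with that show ?thesis by blast
qed

lemma dets_multiple_of_4_3_pow_9: "2^2 * 3^9 * m \<in> integer_group_dets gen_dihedral_Z3_Z3"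
proof (cases m rule: mod_3_cases)
  case (1 k)
  with dets_even_0_mod_3[of k] show ?thesis by simp
next
  case (2 k)
  with dets_even_1_mod_3[of k] show ?thesis by (simp add: algebra_simps)
next
  case (3 k)
  then have "2^2 * 3^9 * m = - (2 * (6 + 18 * k) * 3 ^ 8)" by simp
  then show ?thesis by (simp only: integer_group_dets_uminus dets_even_1_mod_3)
qed

lemma dets_odd_multiple_of_3_pow_9: "3^9 * (2 * m + 1) \<in> integer_group_dets gen_dihedral_Z3_Z3"
proof (cases m rule: mod_3_cases)
  case (1 k)
  with dets_odd_3_mod_18[of k] show ?thesis by (simp add: algebra_simps)
next
  case (2 k)
  with dets_odd_9_mod_18[of k] show ?thesis by (simp add: algebra_simps)
next
  case (3 k)
  then have "3^9 * (2 * m + 1) = - ((3 + 18 * k) * 3 ^ 8)" by simp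
  then show ?thesis by (simp only: integer_group_dets_uminus dets_odd_3_mod_18)
qed

lemma coprime_6_iff: "coprime d 6 \<longleftrightarrow> \<not> 2 dvd d \<and> \<not> 3 dvd d" for d :: int
proof -
  have "coprime d 6 \<longleftrightarrow> coprime d 2 \<and> coprime d 3"
    using coprime_mult_right_iff[of d 2 3] by simp
  moreover have "coprime d p \<longleftrightarrow> \<not> p dvd d" if "prime p" for p :: int
    using that by (metis coprime_commute coprime_absorb_left not_prime_unit prime_imp_coprime)
  ultimately show ?thesis by simp
qed

theorem theorem1p1:
  "{d \<in> integer_group_dets gen_dihedral_Z3_Z3. coprime d 6} =
     {m. [m = 1] (mod 18) \<or> [m = -1] (mod 18)} \<and>
   {d \<in> integer_group_dets gen_dihedral_Z3_Z3. 6 dvd d} =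
     {2^2 * 3^9 * m | m. True} \<and>
   {d \<in> integer_group_dets gen_dihedral_Z3_Z3. 2 dvd d \<and> \<not> 3 dvd d} =
     {2^2 * (9 * m + 2) | m. True} \<union> {2^2 * (9 * m - 2) | m. True} \<and>
   {d \<in> integer_group_dets gen_dihedral_Z3_Z3. 3 dvd d \<and> \<not> 2 dvd d} =
     {3^9 * (2 * m + 1) | m. True}"
proof (intro conjI equalityI subsetI)
  let ?S = "integer_group_dets gen_dihedral_Z3_Z3"
  have mod_9: "d mod 9 = 1 \<or> d mod 9 = 8" if "d \<in> ?S" "\<not> 3 dvd d" for d
    using that dihedral_det_mod_9 unfolding integer_group_dets_eq by (auto simp: cong_def)
  have dvd_3: "3 ^ 9 dvd d" if "d \<in> ?S" "3 dvd d" for d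
    using that three_dvd_dihedral_det unfolding integer_group_dets_eq by blast
  have dvd_4: "4 dvd d" if "d \<in> ?S" "2 dvd d" for d
    using that two_dvd_dihedral_det unfolding integer_group_dets_eq by blast
  have mod_18: "[m = 1] (mod 18) \<or> [m = -1] (mod 18) \<longleftrightarrow> m mod 18 = 1 \<or> m mod 18 = 17" for m :: int
    by (simp add: cong_def)
  fix d :: int
  {
    assume "d \<in> {d \<in> ?S. coprime d 6}"
    then have "d \<in> ?S" and "\<not> 2 dvd d" "\<not> 3 dvd d" by (simp_all add: coprime_6_iff)
    with mod_9 have "d mod 9 = 1 \<or> d mod 9 = 8" by blast
    with \<open>\<not> 2 dvd d\<close> have "d mod 18 = 1 \<or> d mod 18 = 17" by presburger
    then show "d \<in> {m. [m = 1] (mod 18) \<or> [m = -1] (mod 18)}" by (simp add: mod_18)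
  next
    assume "d \<in> {m. [m = 1] (mod 18) \<or> [m = -1] (mod 18)}"
    then have d: "d mod 18 = 1 \<or> d mod 18 = 17" by (simp add: mod_18)
    then have "coprime d 6" unfolding coprime_6_iff by presburger
    moreover from d have "d = 1 + 18 * (d div 18) \<or> d = - (1 + 18 * (- (d div 18) - 1))"
      by presburger
    then have "d \<in> ?S"
      using dets_1_mod_18 integer_group_dets_uminus by metis
    ultimately show "d \<in> {d \<in> ?S. coprime d 6}" by simp
  next
    assume "d \<in> {d \<in> ?S. 6 dvd d}"
    then have "d \<in> ?S" "2 dvd d" "3 dvd d" by (auto elim: dvd_trans[rotated])
    then have "4 dvd d" "3 ^ 9 dvd d" by (simp_all only: dvd_3 dvd_4)
    then obtain n where n: "d = 3 ^ 9 * n" by (elim dvdE)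
    then have "n = 4 * (4921 * n) - d" by simp
    with \<open>4 dvd d\<close> have "4 dvd n" by (metis dvd_diff dvd_triv_left)
    then obtain m where "n = 4 * m" by blast
    with n have "d = 2^2 * 3^9 * m" by simp
    then show "d \<in> {2^2 * 3^9 * m | m. True}" by blast
  next
    assume "d \<in> {2^2 * 3^9 * m | m. True}"
    then show "d \<in> {d \<in> ?S. 6 dvd d}" using dets_multiple_of_4_3_pow_9 by auto
  next
    assume "d \<in> {d \<in> ?S. 2 dvd d \<and> \<not> 3 dvd d}"
    then have "4 dvd d" "d mod 9 = 1 \<or> d mod 9 = 8" using mod_9 dvd_4 by blast+
    then have "(\<exists>m. d = 4 * (9 * m + 2)) \<or> (\<exists>m. d = 4 * (9 * m - 2))" by presburger
    then show "d \<in> {2^2 * (9 * m + 2) | m. True} \<union> {2^2 * (9 * m - 2) | m. True}" by simp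
  next
    assume "d \<in> {2^2 * (9 * m + 2) | m. True} \<union> {2^2 * (9 * m - 2) | m. True}"
    then obtain m where "d = 2^2 * (9 * m + 2) \<or> d = 2^2 * (9 * m - 2)" by blast
    then have "d = 8 + 36 * m \<or> d = - (8 + 36 * (- m))" by auto
    then consider m where "d = 8 + 36 * m" | m where "d = - (8 + 36 * m)" by blast
    then have "d \<in> ?S \<and> 2 dvd d \<and> \<not> 3 dvd d"
    proof cases
      case 1
      then have "2 dvd d \<and> \<not> 3 dvd d" by presburger
      with 1 dets_8_mod_36 show ?thesis by simp
    next
      case 2
      then have "2 dvd d \<and> \<not> 3 dvd d" by presburger
      with 2 integer_group_dets_uminus[OF dets_8_mod_36] show ?thesis by blast
    qed
    then show "d \<in> {d \<in> ?S. 2 dvd d \<and> \<not> 3 dvd d}" by simp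
  next
    assume d: "d \<in> {d \<in> ?S. 3 dvd d \<and> \<not> 2 dvd d}"
    with dvd_3[of d] obtain n where n: "d = 3 ^ 9 * n" by auto
    with d have "odd n" by simp
    with n show "d \<in> {3^9 * (2 * m + 1) | m. True}" by (auto elim: oddE)
  next
    assume "d \<in> {3^9 * (2 * m + 1) | m. True}"
    then show "d \<in> {d \<in> ?S. 3 dvd d \<and> \<not> 2 dvd d}" using dets_odd_multiple_of_3_pow_9 by auto
  }
qed

end
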